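(* Let $c,k,m$ be positive integers. If $k\ge 1+\binom{c}{2}$ and $m\ge 3\,c!/2$, then $f^*(M_{k,m})>c$.
   Context: A digraph $D$ is finite with nonempty vertex set $V(D)$, and is identified with a relation $D\subseteq V(D)\times V(D)$ (its set of edges; loops are allowed). Its adjacency matrix has entry $1$ in position $(u,v)$ if $uv$ is an edge and $0$ otherwise. $\overline{D}=(V(D)\times V(D))\setminus D$ is its complement. A digraph is a Ferrers digraph if its successor sets $\{u: vu\in E\}$, over all vertices $v$, are linearly ordered by inclusion; equivalently, its adjacency matrix has no $2\times 2$ permutation submatrix (two rows and two columns, not necessarily consecutive). $f^*(D)$ is the minimum number of pairwise disjoint Ferrers digraphs on $V(D)$ (as edge sets) whose union is $\overline{D}$. $M_{k,m}$ is the digraph on $km$ vertices whose adjacency matrix is the $km\times km$ matrix consisting of $k$ rows and $k$ columns of $m\times m$ blocks, in which the diagonal blocks are identity matrices, all blocks below the diagonal consist entirely of $0$'s, and all blocks above the diagonal consist entirely of $1$'s. *)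

theory Defs
  imports "Graph_Theory.Pair_Digraph" "Jordan_Normal_Form.Matrix"
begin

definition finite_digraph :: "'a pair_pre_digraph \<Rightarrow> bool" where
  "finite_digraph D \<longleftrightarrow> pair_fin_digraph D \<and> pverts D \<noteq> {}"

definition successors :: "'a pair_pre_digraph \<Rightarrow> 'a \<Rightarrow> 'a set" where
  "successors D v = {u. (v, u) \<in> parcs D}"

definition complement_digraph :: "'a pair_pre_digraph \<Rightarrow> 'a pair_pre_digraph" where
  "complement_digraph D = \<lparr>pverts = pverts D, parcs = (pverts D \<times> pverts D) - parcs D\<rparr>"

definition ferrers :: "'a pair_pre_digraph \<Rightarrow> bool" where
  "ferrers D \<longleftrightarrow> finite_digraph D \<and>
     (\<forall>v\<in>pverts D. \<forall>w\<in>pverts D.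
        successors D v \<subseteq> successors D w \<or> successors D w \<subseteq> successors D v)"

definition ferrers_decomposition ::
    "'a pair_pre_digraph \<Rightarrow> 'a pair_pre_digraph set \<Rightarrow> bool" where
  "ferrers_decomposition D \<F> \<longleftrightarrow> finite \<F> \<and>
     (\<forall>F\<in>\<F>. ferrers F \<and> pverts F = pverts D) \<and>
     pairwise (\<lambda>F G. parcs F \<inter> parcs G = {}) \<F> \<and>
     \<Union>(parcs ` \<F>) = parcs (complement_digraph D)"

text \<open>The members of a decomposition share their vertex set, so counting them as a set of
  digraphs is the same as counting their edge sets. The minimum is attained:
  see \<open>f_star_attained\<close>.\<close>

definition f_star :: "'a pair_pre_digraph \<Rightarrow> nat" where
  "f_star D = (LEAST n. \<exists>\<F>. ferrers_decomposition D \<F> \<and> card \<F> = n)"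

text \<open>The entry of the block matrix at row \<open>i\<close>, column \<open>j\<close> lies in the block with (0-based)
  block row \<open>i div m\<close> and block column \<open>j div m\<close>, at position \<open>(i mod m, j mod m)\<close>.\<close>

definition M_matrix :: "nat \<Rightarrow> nat \<Rightarrow> nat mat" where
  "M_matrix k m = mat (k * m) (k * m) (\<lambda>(i, j).
     if i div m = j div m then 1\<^sub>m m $$ (i mod m, j mod m)
     else if i div m < j div m then 1
     else 0)"

text \<open>Only meaningful for digraphs with vertex set \<open>{0..<n}\<close>.\<close>

definition adjacency_matrix :: "nat pair_pre_digraph \<Rightarrow> nat mat" where
  "adjacency_matrix D = mat (card (pverts D)) (card (pverts D))
     (\<lambda>(u, v). if (u, v) \<in> parcs D then 1 else 0)"

definition M_digraph :: "nat \<Rightarrow> nat \<Rightarrow> nat pair_pre_digraph" where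
  "M_digraph k m = \<lparr>pverts = {0..<k * m},
     parcs = {(u, v). u < k * m \<and> v < k * m \<and> M_matrix k m $$ (u, v) = 1}\<rparr>"

lemma adjacency_matrix_M_digraph: "adjacency_matrix (M_digraph k m) = M_matrix k m"
proof (rule eq_matI)
  fix i j assume "i < dim_row (M_matrix k m)" "j < dim_col (M_matrix k m)"
  then have ij: "i < k * m" "j < k * m" by (simp_all add: M_matrix_def)
  then have "m > 0" by (cases m) auto
  then show "adjacency_matrix (M_digraph k m) $$ (i, j) = M_matrix k m $$ (i, j)"
    using ij by (auto simp: adjacency_matrix_def M_digraph_def M_matrix_def)
qed (auto simp: adjacency_matrix_def M_digraph_def M_matrix_def)

lemma finite_digraph_M_digraph:
  assumes "k > 0" "m > 0"
  shows "finite_digraph (M_digraph k m)"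
proof -
  have "parcs (M_digraph k m) \<subseteq> {0..<k * m} \<times> {0..<k * m}"
    by (auto simp: M_digraph_def)
  moreover have "finite (parcs (M_digraph k m))"
    by (rule finite_subset[OF calculation]) simp
  ultimately show ?thesis
    using assms unfolding finite_digraph_def
    by (auto intro!: pair_fin_digraph.intro pair_wf_digraph.intro pair_fin_digraph_axioms.intro
        simp: M_digraph_def)
qed

lemma ferrers_iff_no_permutation_submatrix:
  assumes "finite_digraph D"
  shows "ferrers D \<longleftrightarrow> (\<nexists>v w x y. (v, x) \<in> parcs D \<and> (w, y) \<in> parcs D \<and>
    (v, y) \<notin> parcs D \<and> (w, x) \<notin> parcs D)"
proof -
  interpret pair_fin_digraph D using assms by (simp add: finite_digraph_def)
  have "v \<in> pverts D" if "(v, x) \<in> parcs D" for v x using in_arcsD1[OF that] .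
  then show ?thesis using assms unfolding ferrers_def successors_def by blast
qed

lemma f_star_attained:
  assumes "finite_digraph D"
  shows "\<exists>\<F>. ferrers_decomposition D \<F> \<and> card \<F> = f_star D"
proof -
  let ?single = "\<lambda>e. \<lparr>pverts = pverts D, parcs = {e}\<rparr>"
  let ?C = "parcs (complement_digraph D)"
  have fin: "finite (pverts D)" and ne: "pverts D \<noteq> {}"
    using assms pair_fin_digraph.pair_finite_verts by (auto simp: finite_digraph_def)
  have "ferrers (?single e)" if "e \<in> ?C" for e
  proof -
    have "finite_digraph (?single e)"
      using that fin ne unfolding finite_digraph_def complement_digraph_def
      by (auto intro!: pair_fin_digraph.intro pair_wf_digraph.intro pair_fin_digraph_axioms.intro)
    then show ?thesis by (simp add: ferrers_iff_no_permutation_submatrix) auto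
  qed
  moreover have "finite ?C" using fin by (simp add: complement_digraph_def)
  ultimately have "ferrers_decomposition D (?single ` ?C)"
    unfolding ferrers_decomposition_def pairwise_def by auto
  then show ?thesis unfolding f_star_def
    using LeastI_ex[of "\<lambda>n. \<exists>\<F>. ferrers_decomposition D \<F> \<and> card \<F> = n"] by blast
qed

end

theory Submission
  imports Defs
begin

text \<open>Suppose the complement of \<open>M\<^sub>k\<^sub>,\<^sub>m\<close> is split into at most \<open>c\<close> disjoint Ferrers relations,
  the colours. In each diagonal block some index \<open>x\<close> has two different colours each of which
  occurs both in row \<open>x\<close> and in column \<open>x\<close> of the block: otherwise, after choosing a colour
  \<open>A\<close> containing all colours common to row \<open>x\<close> and column \<open>x\<close>, the index \<open>x\<close> is determined by
  \<open>A\<close> and the set of the other colours in column \<open>x\<close>, which leaves too few indices. As there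
  are more than \<open>c choose 2\<close> blocks, two of them, with indices \<open>x\<close> (upper) and \<open>y\<close> (lower), share
  the same two colours. Since the blocks above the diagonal contain no edge of the complement,
  the Ferrers property forces the entry \<open>(y, x)\<close> to have both colours.\<close>

text \<open>A colour is an edge set; \<open>V\<close> will be the vertex set of one diagonal
  block.\<close>

definition row_colours :: "'a set \<Rightarrow> ('a \<times> 'a) set set \<Rightarrow> 'a \<Rightarrow> ('a \<times> 'a) set set" where
  "row_colours V F x = {S \<in> F. \<exists>y\<in>V. (x, y) \<in> S}"

definition col_colours :: "'a set \<Rightarrow> ('a \<times> 'a) set set \<Rightarrow> 'a \<Rightarrow> ('a \<times> 'a) set set" where
  "col_colours V F x = {S \<in> F. \<exists>y\<in>V. (y, x) \<in> S}"

text \<open>The left side doubles while \<open>fact d\<close> at least triples. With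
  \<open>d + 1\<close> colours this beats the count of \<open>(d + 1) * (2 ^ d - 2)\<close> codes
  for indices; the summand 4 is twice the subtracted 2.\<close>

lemma two_power_less_fact:
  assumes "2 \<le> d"
  shows "2 * 2 ^ d < 3 * fact d + (4 :: nat)"
  using assms
proof (induction d rule: dec_induct)
  case base
  show ?case by (simp add: numeral_eq_Suc)
next
  case (step n)
  have "(2 :: nat) \<le> fact n"
    using fact_mono[OF step(1), where 'a = nat] by (simp add: numeral_eq_Suc)
  moreover have "3 * fact n \<le> Suc n * (fact n :: nat)"
    using step(1) by (intro mult_right_mono) auto
  moreover have "fact (Suc n) = Suc n * (fact n :: nat)" "(2 :: nat) ^ Suc n = 2 * 2 ^ n"
    by simp_all
  ultimately show ?case using step(3) by linarith
qed

lemma exists_two_common_colours: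
  assumes fin: "finite V" "finite F"
    and cover: "\<And>x y. x \<in> V \<Longrightarrow> y \<in> V \<Longrightarrow> x \<noteq> y \<Longrightarrow> \<exists>S\<in>F. (x, y) \<in> S"
    and asym: "\<And>S x y. S \<in> F \<Longrightarrow> x \<in> V \<Longrightarrow> y \<in> V \<Longrightarrow> (x, y) \<in> S \<Longrightarrow> (y, x) \<notin> S"
    and card: "3 * fact (card F) \<le> 2 * card V"
  shows "\<exists>x\<in>V. \<exists>A B. A \<noteq> B \<and> {A, B} \<subseteq> row_colours V F x \<inter> col_colours V F x"
proof (rule ccontr)
  assume none: "\<not> ?thesis"
  let ?R = "row_colours V F" and ?C = "col_colours V F"
  have uniq: "A = B"
    if "x \<in> V" "A \<in> ?R x" "A \<in> ?C x" "B \<in> ?R x" "B \<in> ?C x" for x A B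
    using none that by blast
  have sub: "?R x \<subseteq> F" "?C x \<subseteq> F" for x
    by (auto simp: row_colours_def col_colours_def)
  have meet: "S \<in> ?R x \<inter> ?C y" if "x \<in> V" "y \<in> V" "S \<in> F" "(x, y) \<in> S" for x y S
    using that by (auto simp: row_colours_def col_colours_def)
  have "(1 :: nat) \<le> fact (card F)" by (rule fact_ge_1)
  then have V2: "2 \<le> card V" using card by linarith
  have other: "\<exists>z\<in>V. z \<noteq> x" for x
  proof (rule ccontr)
    assume "\<not> ?thesis"
    then have "V \<subseteq> {x}" by blast
    from card_mono[OF _ this] V2 show False by simp
  qed
  have nonempty: "?R x \<noteq> {}" "?C x \<noteq> {}" if "x \<in> V" for x
    using other[of x] that cover meet by blast+
  \<comment> \<open>If \<open>A\<close> contains \<open>(x, y)\<close> and \<open>(z, x)\<close>,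
    asymmetry gives the reversed pairs \<open>(y, x)\<close> and \<open>(x, z)\<close> other
    colours.\<close>
  have extremal: "\<not> ?R x \<subseteq> {A}" "\<not> ?C x \<subseteq> {A}"
    if x: "x \<in> V" and A: "A \<in> ?R x" "A \<in> ?C x" for x A
  proof -
    obtain y z where yz: "A \<in> F" "y \<in> V" "(x, y) \<in> A" "z \<in> V" "(z, x) \<in> A"
      using A by (auto simp: row_colours_def col_colours_def)
    then have "x \<noteq> y" "x \<noteq> z" using asym x by blast+
    obtain S where S: "S \<in> F" "(x, z) \<in> S" using cover x yz \<open>x \<noteq> z\<close> by blast
    obtain T where T: "T \<in> F" "(y, x) \<in> T" using cover x yz \<open>x \<noteq> y\<close> by blast
    have "S \<noteq> A" "T \<noteq> A" using asym[of A] S T x yz by blast+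
    with S T show "\<not> ?R x \<subseteq> {A}" "\<not> ?C x \<subseteq> {A}"
      using meet x yz by blast+
  qed
  \<comment> \<open>Three colours are needed to pick \<open>A\<close> apart from one row colour and
    one column colour when row and column share none.\<close>
  consider "card F \<le> 2" | "3 \<le> card F" by linarith
  then show False
  proof cases
    case 1
    \<comment> \<open>A shared colour would come with a further row colour and a further column
      colour, distinct by \<open>uniq\<close>: three colours in all.\<close>
    have disj: "?R x \<inter> ?C x = {}" if x: "x \<in> V" for x
    proof (rule ccontr)
      assume "?R x \<inter> ?C x \<noteq> {}"
      then obtain A where A: "A \<in> ?R x" "A \<in> ?C x" by blast
      then obtain B B' where B: "B \<in> ?R x" "B \<noteq> A" "B' \<in> ?C x" "B' \<noteq> A"
        using extremal[OF x A] by blast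
      then have "B \<noteq> B'" using uniq[OF x A] by blast
      then have "card {A, B, B'} = 3" using B by auto
      moreover have "{A, B, B'} \<subseteq> F" using A B sub by blast
      ultimately show False using card_mono[OF fin(2), of "{A, B, B'}"] 1 by linarith
    qed
    have "inj_on ?C V"
    proof (rule inj_onI, rule ccontr)
      fix x y assume xy: "x \<in> V" "y \<in> V" "?C x = ?C y" "x \<noteq> y"
      then obtain S where "S \<in> F" "(x, y) \<in> S" using cover by blast
      then have "S \<in> ?R x \<inter> ?C x" using meet xy by auto
      then show False using disj xy by blast
    qed
    moreover have "?C ` V \<subseteq> Pow F - {{}, F}"
    proof (rule image_subsetI)
      fix x assume "x \<in> V"
      then show "?C x \<in> Pow F - {{}, F}" using nonempty[of x] disj[of x] sub[of x] by blast
    qed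
    ultimately have V: "card V \<le> card (Pow F - {{}, F})"
      using card_inj_on_le fin by (metis finite_Diff finite_Pow_iff)
    \<comment> \<open>There are 0, 0 and 2 admissible column sets respectively, whereas
      \<open>V\<close> has at least 2 elements, and at least 3 when there are two colours.\<close>
    consider "card F = 0" | "card F = 1" | "card F = 2" using 1 by linarith
    then show False
    proof cases
      case 1
      then show False using V V2 fin by simp
    next
      case 2
      then obtain A where "F = {A}" by (auto simp: card_1_singleton_iff)
      then have "Pow F - {{}, F} = {}" by auto
      then have "card (Pow F - {{}, F}) = 0" by (simp only: card.empty)
      then show False using V V2 by linarith
    next
      case 3
      then have "{} \<noteq> F" by auto
      then have "card (Pow F - {{}, F}) = 2"
        using fin 3 by (subst card_Diff_subset) (auto simp: card_Pow)
      then show False using V card 3 by (simp add: numeral_eq_Suc)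
    qed
  next
    case 2
    have "\<exists>A\<in>F. ?R x \<inter> ?C x \<subseteq> {A} \<and> \<not> ?R x \<subseteq> {A} \<and> \<not> ?C x \<subseteq> {A}" if x: "x \<in> V" for x
    proof (cases "?R x \<inter> ?C x = {}")
      case False
      then obtain A where "A \<in> ?R x" "A \<in> ?C x" by blast
      moreover from this have "?R x \<inter> ?C x \<subseteq> {A}" using uniq[OF x] by blast
      ultimately show ?thesis using extremal[OF x, of A] sub[of x] by blast
    next
      case True
      obtain P Q where PQ: "P \<in> ?R x" "Q \<in> ?C x" using nonempty[OF x] by blast
      have "\<not> F \<subseteq> {P, Q}"
      proof
        assume "F \<subseteq> {P, Q}"
        from card_mono[OF _ this] have "card F \<le> card {P, Q}" by simp
        also have "\<dots> \<le> 2" by (simp add: card_insert_if)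
        finally show False using 2 by simp
      qed
      then obtain A where "A \<in> F" "A \<noteq> P" "A \<noteq> Q" by blast
      then show ?thesis using True PQ by blast
    qed
    then obtain f where f: "\<And>x. x \<in> V \<Longrightarrow> f x \<in> F \<and> ?R x \<inter> ?C x \<subseteq> {f x} \<and>
        \<not> ?R x \<subseteq> {f x} \<and> \<not> ?C x \<subseteq> {f x}"
      by metis
    let ?g = "\<lambda>x. (f x, ?C x - {f x})"
    let ?T = "SIGMA A:F. Pow (F - {A}) - {{}, F - {A}}"
    have "inj_on ?g V"
    \<comment> \<open>If the codes agree, a colour of \<open>(x, y)\<close> other than
      \<open>f x\<close> would lie in column \<open>x\<close> as well as in row \<open>x\<close>,
      which is excluded. So \<open>(x, y)\<close>, and likewise \<open>(y, x)\<close>, has colour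
      \<open>f x\<close>, against asymmetry.\<close>
    proof (rule inj_onI, rule ccontr)
      fix x y assume xy: "x \<in> V" "y \<in> V" "?g x = ?g y" "x \<noteq> y"
      then obtain S T where ST: "S \<in> F" "(x, y) \<in> S" "T \<in> F" "(y, x) \<in> T"
        using cover by metis
      have "S = f x"
        using meet[OF xy(1,2) ST(1,2)] xy f[OF xy(1)] by auto
      moreover have "T = f x"
        using meet[OF xy(2,1) ST(3,4)] xy f[OF xy(2)] by auto
      ultimately show False using asym[OF ST(1) xy(1,2) ST(2)] ST(4) by simp
    qed
    moreover have "?g ` V \<subseteq> ?T"
    proof (rule image_subsetI)
      fix x assume "x \<in> V"
      note fx = f[OF this]
      \<comment> \<open>A row colour other than \<open>f x\<close> is missing from column
        \<open>x\<close>, so the second component is not all of \<open>F - {f x}\<close>.\<close>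
      then obtain B where "B \<in> ?R x" "B \<noteq> f x" by blast
      then have "B \<in> F - {f x}" "B \<notin> ?C x" using fx sub[of x] by blast+
      then show "?g x \<in> ?T" using fx sub[of x] by blast
    qed
    ultimately have V: "card V \<le> card ?T"
      using fin by (intro card_inj_on_le) auto
    obtain d where d: "card F = Suc d" "2 \<le> d" using 2 by (cases "card F") auto
    have "card (Pow (F - {A}) - {{}, F - {A}}) = 2 ^ d - 2" if "A \<in> F" for A
    proof -
      have "card (F - {A}) = d" using that d by simp
      moreover from this have "{} \<noteq> F - {A}" using d(2) by fastforce
      ultimately show ?thesis
        using fin by (subst card_Diff_subset) (auto simp: card_Pow)
    qed
    then have "card ?T = Suc d * (2 ^ d - 2)" using fin d by (simp add: card_SigmaI)
    then have "3 * (Suc d * fact d) \<le> 2 * (Suc d * (2 ^ d - 2))"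
      using V card d by simp
    then have "Suc d * (3 * fact d) \<le> Suc d * (2 * (2 ^ d - 2))"
      by (simp only: mult.left_commute)
    then have "3 * fact d \<le> 2 * (2 ^ d - (2 :: nat))"
      by (simp only: Suc_mult_le_cancel1)
    moreover have "0 < (fact d :: nat)" by simp
    ultimately show False using two_power_less_fact[OF d(2)] by linarith
  qed
qed

lemma parcs_M_digraph:
  assumes "m > 0"
  shows "(u, v) \<in> parcs (M_digraph k m) \<longleftrightarrow>
    u < k * m \<and> v < k * m \<and> (u = v \<or> u div m < v div m)"
proof -
  have eq: "u = v \<longleftrightarrow> u div m = v div m \<and> u mod m = v mod m"
    by (metis div_mult_mod_eq)
  have "M_matrix k m $$ (u, v) = 1 \<longleftrightarrow> u = v \<or> u div m < v div m" if "u < k * m" "v < k * m"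
    unfolding eq using that assms by (simp add: M_matrix_def)
  then show ?thesis by (auto simp: M_digraph_def)
qed

theorem theorem6:
  fixes c k m :: nat
  assumes "c > 0" and "k > 0" and "m > 0"
    and "k \<ge> 1 + (c choose 2)"
    and "real m \<ge> 3 * fact c / 2"
  shows "f_star (M_digraph k m) > c"
proof (rule ccontr)
  assume le: "\<not> f_star (M_digraph k m) > c"
  let ?D = "M_digraph k m"
  obtain \<F> where \<F>: "ferrers_decomposition ?D \<F>" "card \<F> \<le> c"
    using f_star_attained[OF finite_digraph_M_digraph[OF assms(2,3)]] le by auto
  define F where "F = parcs ` \<F>"
  have finF: "finite F" and cardF: "card F \<le> c"
    using \<F> card_image_le[of \<F> parcs]
    by (auto simp: ferrers_decomposition_def F_def)
  have ferrers: "(v, y) \<in> S \<or> (w, x) \<in> S"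
    if "S \<in> F" "(v, x) \<in> S" "(w, y) \<in> S" for S v w x y
    using that \<F>(1) ferrers_iff_no_permutation_submatrix
    unfolding F_def ferrers_decomposition_def ferrers_def by blast
  have disj: "S = T" if ST: "S \<in> F" "T \<in> F" "e \<in> S" "e \<in> T" for S T e
  proof -
    obtain G H where GH: "G \<in> \<F>" "S = parcs G" "H \<in> \<F>" "T = parcs H"
      using ST(1,2) by (auto simp: F_def)
    have "pairwise (\<lambda>G H. parcs G \<inter> parcs H = {}) \<F>"
      using \<F>(1) by (simp add: ferrers_decomposition_def)
    then have "G = H" using GH ST(3,4) by (auto simp: pairwise_def)
    then show ?thesis using GH by simp
  qed
  have union: "\<Union>F = parcs (complement_digraph ?D)"
    using \<F>(1) by (simp add: F_def ferrers_decomposition_def)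
  have union_iff: "(\<exists>S\<in>F. (u, v) \<in> S) \<longleftrightarrow>
      u < k * m \<and> v < k * m \<and> u \<noteq> v \<and> v div m \<le> u div m" for u v
  proof -
    have "(\<exists>S\<in>F. (u, v) \<in> S) \<longleftrightarrow> (u, v) \<in> \<Union>F" by blast
    also have "\<dots> \<longleftrightarrow> u < k * m \<and> v < k * m \<and> u \<noteq> v \<and> v div m \<le> u div m"
      unfolding union complement_digraph_def using parcs_M_digraph[OF assms(3), of u v k]
      by (auto simp: M_digraph_def)
    finally show ?thesis .
  qed
  define V where "V i = {i * m..<i * m + m}" for i
  have divV: "u div m = i" if "u \<in> V i" for u i
    using that assms(3) by (auto simp: V_def mult.commute intro!: div_nat_eqI)
  have ltV: "u < k * m" if "u \<in> V i" "i < k" for u i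
    using divV[OF that(1)] that(2) assms(3) div_less_iff_less_mult[of m u k] by simp
  have "real (3 * fact (card F)) \<le> real (2 * m)"
    using fact_mono[OF cardF, where 'a = real] assms(5) by simp
  then have size: "3 * fact (card F) \<le> 2 * card (V i)" for i
    unfolding of_nat_le_iff by (simp add: V_def)
  have block: "\<exists>x\<in>V i. \<exists>A B. A \<noteq> B \<and> {A, B} \<subseteq> row_colours (V i) F x \<inter> col_colours (V i) F x"
    if i: "i < k" for i
  proof (rule exists_two_common_colours)
    fix x y assume "x \<in> V i" "y \<in> V i" "x \<noteq> y"
    then show "\<exists>S\<in>F. (x, y) \<in> S" using union_iff ltV divV i by simp
  next
    fix S x y assume "S \<in> F" "(x, y) \<in> S"
    \<comment> \<open>Two opposite edges in a Ferrers relation force a loop at \<open>x\<close> or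
      \<open>y\<close>, but the complement has no loops.\<close>
    then show "(y, x) \<notin> S" using ferrers[of S x y y x] union_iff by blast
  qed (use finF size in \<open>auto simp: V_def\<close>)
  then obtain x where x: "\<And>i. i < k \<Longrightarrow> x i \<in> V i \<and> (\<exists>A B. A \<noteq> B \<and>
      {A, B} \<subseteq> row_colours (V i) F (x i) \<inter> col_colours (V i) F (x i))"
    by metis
  then obtain A B where AB: "\<And>i. i < k \<Longrightarrow> A i \<noteq> B i \<and>
      {A i, B i} \<subseteq> row_colours (V i) F (x i) \<inter> col_colours (V i) F (x i)"
    by metis
  let ?P = "{P. P \<subseteq> F \<and> card P = 2}"
  \<comment> \<open>Pigeonhole: the 1 in the bound on \<open>k\<close> makes the blocks outnumber
    the pairs of colours.\<close>
  have "card ?P = card F choose 2" by (rule n_subsets[OF finF])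
  also have "\<dots> \<le> c choose 2" using cardF by (rule binomial_right_mono)
  also have "\<dots> < card {..<k}" using assms(4) by simp
  finally have "card ?P < card {..<k}" .
  moreover have "(\<lambda>i. {A i, B i}) ` {..<k} \<subseteq> ?P"
  proof (rule image_subsetI)
    fix i assume "i \<in> {..<k}"
    then show "{A i, B i} \<in> ?P" using AB[of i] by (auto simp: row_colours_def)
  qed
  ultimately have "\<not> inj_on (\<lambda>i. {A i, B i}) {..<k}"
    using card_inj_on_le[of "\<lambda>i. {A i, B i}" "{..<k}" ?P] finF by auto
  then obtain i j where ij: "i < j" "i < k" "j < k" "{A i, B i} = {A j, B j}"
    unfolding inj_on_def by (metis lessThan_iff linorder_neqE_nat)
  have "(x j, x i) \<in> S" if S: "S \<in> {A i, B i}" for S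
  proof -
    have "S \<in> col_colours (V i) F (x i)" using AB[OF ij(2)] S by blast
    then obtain p where p: "S \<in> F" "p \<in> V i" "(p, x i) \<in> S" by (auto simp: col_colours_def)
    have "S \<in> {A j, B j}" using S ij(4) by simp
    then have "S \<in> row_colours (V j) F (x j)" using AB[OF ij(3)] by blast
    then obtain q where q: "q \<in> V j" "(x j, q) \<in> S" by (auto simp: row_colours_def)
    \<comment> \<open>Since \<open>p\<close> lies in block \<open>i\<close> and \<open>q\<close> in
      the later block \<open>j\<close>, the entry \<open>(p, q)\<close> is above the diagonal
      blocks. Of the two crossing entries only \<open>(x j, x i)\<close> remains.\<close>
    have "(p, q) \<notin> S" using union_iff[of p q] divV[OF p(2)] divV[OF q(1)] ij(1) p(1) by auto
    then show ?thesis using ferrers p q by blast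
  qed
  moreover have "A i \<in> F" "B i \<in> F" "A i \<noteq> B i"
    using AB[OF ij(2)] by (auto simp: row_colours_def)
  ultimately show False using disj[of "A i" "B i" "(x j, x i)"] by simp
qed

end
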